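(* Consider the two-stage DPG method $$u_{n+1}=e^{hJ_n}u_n+hb_1(hJ_n)g_n(u_n)+hb_2(hJ_n)g_n(u_{n_2}),\qquad u_{n_2}=u_n+h\varphi_2(hJ_n)\bigl(g_n(u_n)+J_nu_n\bigr),$$ with coefficient functions satisfying $$b_1(hJ_n)+b_2(hJ_n)=\varphi_1(hJ_n),\qquad \tfrac18\,b_2(hJ_n)=\varphi_3(hJ_n).$$ Then the method is third order, in the sense that its local truncation error $\hat e_{n+1}=\bar u_{n+1}-u(t_{n+1})$ satisfies $$\hat e_{n+1}=\mathcal O(h^4).$$
   Context: Let $X$ be a Banach space with norm $\|\cdot\|$, $T>0$, and consider $u'(t)=F(u(t))$, $u(0)=u_0$ on $[0,T]$. Assumption 1: $u\in C([0,T);X)\cap C^1((0,T);X)$, and $F:X\to X$ is sufficiently many times Fréchet differentiable in a strip along the exact solution $u$ with all derivatives uniformly bounded; hence the Jacobian $J(v)=\frac{\partial F}{\partial u}(v)$ satisfies $\|J(v)-J(w)\|_{\mathcal L(X)}\le C\|v-w\|$ in a neighborhood of the exact solution. Assumption 2: the linear operator $J=J(v)$ generates a strongly continuous semigroup on $X$, with constants $C,\omega$ such that $\|e^{tJ}\|_{\mathcal L(X)}\le Ce^{\omega t}$, $t\ge0$, uniformly in a neighborhood of the exact solution (i.e. for all $v$ there). Uniform grid: $0=t_0<\dots<t_N=T$, $h=t_{n+1}-t_n$; $u(T)$ is understood by continuity. $u_n\approx u(t_n)$ denotes the numerical solution, $J_n=\frac{\partial F}{\partial u}(u_n)$, $g_n(v)=F(v)-J_nv$.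 The $\varphi$-functions are $\varphi_0(z)=e^z$ and $\varphi_p(z)=\int_0^1e^{(1-\theta)z}\frac{\theta^{p-1}}{(p-1)!}\,d\theta$ for $p\ge1$; applied to $hJ$ via the semigroup $e^{tJ}$. Local truncation error: put $\hat u_n=u(t_n)$, $\hat J_n=\frac{\partial F}{\partial u}(\hat u_n)$, $\hat g_n(v)=F(v)-\hat J_nv$. Then $\bar u_{n+1}$ (with internal stage $\bar u_{n_2}$) is the result of one step of the method started from $\hat u_n$, i.e. with $u_n,J_n,g_n$ replaced by $\hat u_n,\hat J_n,\hat g_n$. $\mathcal O(h^k)$ means bounded in norm by $Ch^k$ as $h\to0$ with $C$ independent of $n$ and $h$. *)

theory Defs
  imports "HOL-Analysis.Analysis"
begin

text \<open>Only the values \<open>S t\<close> for \<open>t \<ge> 0\<close> are constrained.\<close>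

definition C0_semigroup :: "(real \<Rightarrow> 'a::banach \<Rightarrow>\<^sub>L 'a) \<Rightarrow> bool" where
  "C0_semigroup S \<longleftrightarrow>
     S 0 = id_blinfun \<and>
     (\<forall>s\<ge>0. \<forall>t\<ge>0. S (s + t) = S s o\<^sub>L S t) \<and>
     (\<forall>x. continuous_on {0..} (\<lambda>t. blinfun_apply (S t) x))"

text \<open>The operator \<open>A\<close> is everywhere defined and bounded here, because it is a Frechet derivative
  of a map of the whole space into itself; the domain of the generator is therefore the whole space.\<close>

definition generates_C0_semigroup ::
    "('a::banach \<Rightarrow>\<^sub>L 'a) \<Rightarrow> (real \<Rightarrow> 'a \<Rightarrow>\<^sub>L 'a) \<Rightarrow> bool" where
  "generates_C0_semigroup A S \<longleftrightarrow>
     C0_semigroup S \<and>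
     (\<forall>x. ((\<lambda>t. (blinfun_apply (S t) x - x) /\<^sub>R t) \<longlongrightarrow> blinfun_apply A x) (at_right 0))"

text \<open>\<open>phi S p h\<close> is the operator \<open>\<phi>\<^sub>p(hA)\<close> if \<open>S\<close> is the semigroup generated by \<open>A\<close>, i.e.
  \<open>S ((1 - \<theta>) * h)\<close> is \<open>e\<^bsup>(1-\<theta>)hA\<^esup>\<close>. The integral is taken pointwise (strongly), since \<open>S\<close> need not be
  continuous in the operator norm. That the integral does define a bounded operator is
  \<open>blinfun_apply_phi\<close> below.\<close>

definition phi :: "(real \<Rightarrow> 'a::banach \<Rightarrow>\<^sub>L 'a) \<Rightarrow> nat \<Rightarrow> real \<Rightarrow> 'a \<Rightarrow>\<^sub>L 'a" where
  "phi S p h =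
     (if p = 0 then S h
      else Blinfun (\<lambda>x. integral {0..1}
             (\<lambda>\<theta>. (\<theta> ^ (p - 1) / fact (p - 1)) *\<^sub>R blinfun_apply (S ((1 - \<theta>) * h)) x)))"

lemma blinfun_apply_phi:
  fixes S :: "real \<Rightarrow> 'a::banach \<Rightarrow>\<^sub>L 'a"
  assumes S: "C0_semigroup S" and bound: "\<And>t. t \<ge> 0 \<Longrightarrow> norm (S t) \<le> C * exp (\<omega> * t)"
    and h: "h \<ge> 0" and p: "p \<ge> 1"
  shows "blinfun_apply (phi S p h) x = integral {0..1}
           (\<lambda>\<theta>. (\<theta> ^ (p - 1) / fact (p - 1)) *\<^sub>R blinfun_apply (S ((1 - \<theta>) * h)) x)"
proof -
  define f where "f = (\<lambda>x \<theta>. (\<theta> ^ (p - 1) / fact (p - 1)) *\<^sub>R blinfun_apply (S ((1 - \<theta>) * h)) x)"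
  have cont: "continuous_on {0..1} (f x)" for x
  proof -
    have c: "continuous_on {0..} (\<lambda>t. blinfun_apply (S t) x)"
      using S by (simp add: C0_semigroup_def)
    have "continuous_on {0..1} (\<lambda>\<theta>. blinfun_apply (S ((1 - \<theta>) * h)) x)"
      by (rule continuous_on_compose2[OF c]) (use h in \<open>auto intro!: continuous_intros\<close>)
    moreover have "continuous_on {0..1} (\<lambda>\<theta>::real. \<theta> ^ (p - 1) / fact (p - 1))"
      by (intro continuous_intros) auto
    ultimately show ?thesis
      unfolding f_def by (rule continuous_on_scaleR[rotated])
  qed
  have int: "f x integrable_on {0..1}" for x
    by (rule integrable_continuous_interval[OF cont])
  define B where "B = \<bar>C\<bar> * exp (\<bar>\<omega>\<bar> * h)"
  have B: "norm (f x \<theta>) \<le> B * norm x" if "\<theta> \<in> {0..1}" for x \<theta>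
  proof -
    have t: "0 \<le> (1 - \<theta>) * h" "(1 - \<theta>) * h \<le> h"
      using that h by (auto simp: mult_left_le_one_le)
    have "\<omega> * ((1 - \<theta>) * h) \<le> \<bar>\<omega>\<bar> * h"
      by (rule mult_mono) (use t in auto)
    then have "C * exp (\<omega> * ((1 - \<theta>) * h)) \<le> B"
      unfolding B_def by (intro mult_mono) auto
    then have n: "norm (S ((1 - \<theta>) * h)) \<le> B"
      using bound[OF t(1)] by linarith
    have B0: "B \<ge> 0" unfolding B_def by simp
    have w: "0 \<le> \<theta> ^ (p - 1) / fact (p - 1)" "\<theta> ^ (p - 1) / fact (p - 1) \<le> 1"
    proof -
      have "\<theta> ^ (p - 1) \<le> 1" using that by (simp add: power_le_one)
      also have "(1::real) \<le> fact (p - 1)" by simp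
      finally show "\<theta> ^ (p - 1) / fact (p - 1) \<le> 1" by simp
    qed (use that in simp)
    have "norm (blinfun_apply (S ((1 - \<theta>) * h)) x) \<le> B * norm x"
      using norm_blinfun[of "S ((1 - \<theta>) * h)" x] n
      by (meson mult_right_mono norm_ge_zero order_trans)
    moreover have "norm (f x \<theta>) \<le> 1 * norm (blinfun_apply (S ((1 - \<theta>) * h)) x)"
      unfolding f_def norm_scaleR real_norm_def abs_of_nonneg[OF w(1)]
      by (rule mult_right_mono[OF w(2) norm_ge_zero])
    ultimately show ?thesis by linarith
  qed
  have "bounded_linear (\<lambda>x. integral {0..1} (f x))"
  proof (rule bounded_linear_intro)
    fix x y show "integral {0..1} (f (x + y)) = integral {0..1} (f x) + integral {0..1} (f y)"
      unfolding integral_add[OF int int, symmetric]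
      by (simp add: f_def blinfun.add_right scaleR_add_right)
  next
    fix r x show "integral {0..1} (f (r *\<^sub>R x)) = r *\<^sub>R integral {0..1} (f x)"
      unfolding integral_cmul[symmetric]
      by (simp add: f_def blinfun.scaleR_right mult.commute)
  next
    fix x show "norm (integral {0..1} (f x)) \<le> norm x * B"
      using integral_bound[OF _ cont, where B = "B * norm x"] B by (simp add: mult.commute)
  qed
  then show ?thesis
    using p by (simp add: phi_def f_def bounded_linear_Blinfun_apply)
qed

text \<open>In the following, \<open>J v\<close> stands for the Jacobian at \<open>v\<close>, and \<open>S v\<close> for the semigroup
  generated by \<open>J v\<close>.\<close>

definition nonlin :: "('a::banach \<Rightarrow> 'a) \<Rightarrow> ('a \<Rightarrow> 'a \<Rightarrow>\<^sub>L 'a) \<Rightarrow> 'a \<Rightarrow> 'a \<Rightarrow> 'a" where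
  "nonlin F J v w = F w - blinfun_apply (J v) w"

definition dpg_stage ::
    "('a::banach \<Rightarrow> 'a) \<Rightarrow> ('a \<Rightarrow> 'a \<Rightarrow>\<^sub>L 'a) \<Rightarrow> ('a \<Rightarrow> real \<Rightarrow> 'a \<Rightarrow>\<^sub>L 'a) \<Rightarrow> real \<Rightarrow> 'a \<Rightarrow> 'a" where
  "dpg_stage F J S h v =
     v + h *\<^sub>R blinfun_apply (phi (S v) 2 h) (nonlin F J v v + blinfun_apply (J v) v)"

definition dpg_step ::
    "(('a::banach \<Rightarrow>\<^sub>L 'a) \<Rightarrow> 'a \<Rightarrow>\<^sub>L 'a) \<Rightarrow> (('a \<Rightarrow>\<^sub>L 'a) \<Rightarrow> 'a \<Rightarrow>\<^sub>L 'a) \<Rightarrow>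
     ('a \<Rightarrow> 'a) \<Rightarrow> ('a \<Rightarrow> 'a \<Rightarrow>\<^sub>L 'a) \<Rightarrow> ('a \<Rightarrow> real \<Rightarrow> 'a \<Rightarrow>\<^sub>L 'a) \<Rightarrow> real \<Rightarrow> 'a \<Rightarrow> 'a" where
  "dpg_step b1 b2 F J S h v =
     blinfun_apply (S v h) v
     + h *\<^sub>R blinfun_apply (b1 (h *\<^sub>R J v)) (nonlin F J v v)
     + h *\<^sub>R blinfun_apply (b2 (h *\<^sub>R J v)) (nonlin F J v (dpg_stage F J S h v))"

definition grid :: "real \<Rightarrow> nat \<Rightarrow> nat \<Rightarrow> real" where
  "grid T N n = real n * (T / real N)"

text \<open>\<open>local_error \<dots> N n\<close> is the error committed by one step from
  \<open>t\<^sub>n\<close> to \<open>t\<^bsub>n+1\<^esub>\<close> on the grid with \<open>N\<close> steps, started on the exact solution \<open>u\<close>.\<close>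

definition local_error ::
    "(('a::banach \<Rightarrow>\<^sub>L 'a) \<Rightarrow> 'a \<Rightarrow>\<^sub>L 'a) \<Rightarrow> (('a \<Rightarrow>\<^sub>L 'a) \<Rightarrow> 'a \<Rightarrow>\<^sub>L 'a) \<Rightarrow>
     ('a \<Rightarrow> 'a) \<Rightarrow> ('a \<Rightarrow> 'a \<Rightarrow>\<^sub>L 'a) \<Rightarrow> ('a \<Rightarrow> real \<Rightarrow> 'a \<Rightarrow>\<^sub>L 'a) \<Rightarrow>
     (real \<Rightarrow> 'a) \<Rightarrow> real \<Rightarrow> nat \<Rightarrow> nat \<Rightarrow> 'a" where
  "local_error b1 b2 F J S u T N n =
     dpg_step b1 b2 F J S (T / real N) (u (grid T N n)) - u (grid T N (Suc n))"

definition strip :: "(real \<Rightarrow> 'a::banach) \<Rightarrow> real \<Rightarrow> real \<Rightarrow> 'a set" where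
  "strip u T r = (\<Union>t\<in>{0..T}. ball (u t) r)"

end

theory Submission
  imports Defs
begin

text \<open>Fix a grid point \<open>t\<close> and write \<open>v = u t\<close>, \<open>A = J v\<close>, \<open>f = F v\<close> and
  \<open>g w = F w - A w\<close>. The equation \<open>u' = A u + g u\<close> gives the variation-of-constants formula
  \<open>u (t + h) = e\<^bsup>hA\<^esup> v + h \<integral>\<^bsub>0..1\<^esub> e\<^bsup>(1-\<theta>)hA\<^esup> g (u (t + \<theta>h)) d\<theta>\<close>
  (\<open>variation_of_constants\<close>). Because the linear part is the Jacobian at \<open>v\<close> itself, \<open>g\<close> has
  derivative zero at \<open>v\<close>, so that \<open>g (v + d) - g v = 1/2 F'' v d d + O(\<parallel>d\<parallel>\<^sup>3)\<close>. Hence \<open>d\<close> is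
  needed only to first order: if \<open>d = c h f + O(h\<^sup>2)\<close>, then
  \<open>g (v + d) - g v = (c\<^sup>2/2) q + O(h\<^sup>3)\<close> with \<open>q = h\<^sup>2 F'' v f f\<close>
  (\<open>norm_nonlin_along_tangent_le\<close>).

  This is applied twice. On the exact solution \<open>u (t + \<theta>h) = v + \<theta>h f + O(h\<^sup>2)\<close>, so \<open>c = \<theta>\<close>; the
  integral of \<open>\<theta>\<^sup>2/2\<close> against the semigroup is \<open>\<phi>\<^sub>3\<close>, and the formula yields
  \<open>e\<^bsup>hA\<^esup> v + h \<phi>\<^sub>1 g v + h \<phi>\<^sub>3 q + O(h\<^sup>4)\<close>. In the stage, \<open>\<phi>\<^sub>2(hA) = 1/2 + O(h)\<close>, so \<open>c = 1/2\<close> and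
  \<open>g\<close> changes by \<open>q/8 + O(h\<^sup>3)\<close>. The conditions on the coefficients turn the numerical step
  into \<open>e\<^bsup>hA\<^esup> v + h \<phi>\<^sub>1 g v + 8 h \<phi>\<^sub>3 (g stage - g v)\<close>, and the \<open>q\<close> terms of the two expansions cancel
  (\<open>exponential_quadrature_error\<close>). What remains is \<open>h\<close> times two remainders of size
  \<open>O(h\<^sup>3)\<close>.

  All constants depend on \<open>M\<close>, on a
  bound \<open>P\<close> for \<open>F\<close> along the solution (which is continuous on a compact interval), and on a
  bound \<open>B\<close> for the semigroups on \<open>[0, T]\<close>, hence neither on \<open>n\<close> nor on \<open>h\<close>.\<close>

section \<open>Calculus in Banach spaces\<close>

lemma has_vector_derivative_iff_quotient:
  fixes f :: "real \<Rightarrow> 'a::real_normed_vector"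
  shows "(f has_vector_derivative f') (at x within S) \<longleftrightarrow>
    ((\<lambda>y. (f y - f x) /\<^sub>R (y - x)) \<longlongrightarrow> f') (at x within S)"
proof -
  have eq: "norm (f y - f x - (y - x) *\<^sub>R f') / norm (y - x) =
      norm ((f y - f x) /\<^sub>R (y - x) - f')" if "y \<noteq> x" for y
  proof -
    have "f y - f x - (y - x) *\<^sub>R f' = (y - x) *\<^sub>R ((f y - f x) /\<^sub>R (y - x) - f')"
      using that by (simp add: scaleR_diff_right)
    then show ?thesis using that by simp
  qed
  have "((\<lambda>y. norm (f y - f x - (y - x) *\<^sub>R f') / norm (y - x)) \<longlongrightarrow> 0) (at x within S) \<longleftrightarrow>
    ((\<lambda>y. norm ((f y - f x) /\<^sub>R (y - x) - f')) \<longlongrightarrow> 0) (at x within S)"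
    by (rule filterlim_cong[OF refl refl]) (use eq in \<open>simp add: eventually_at_filter\<close>)
  also have "\<dots> \<longleftrightarrow> ((\<lambda>y. (f y - f x) /\<^sub>R (y - x)) \<longlongrightarrow> f') (at x within S)"
    by (simp add: tendsto_norm_zero_iff LIM_zero_iff)
  finally show ?thesis
    by (simp add: has_vector_derivative_def has_derivative_iff_norm bounded_linear_scaleR_left)
qed

lemma norm_increment_le:
  fixes f :: "real \<Rightarrow> 'a::banach"
  assumes "a \<le> b" "continuous_on {a..b} f"
    and "\<And>x. x \<in> {a<..<b} \<Longrightarrow> (f has_vector_derivative f' x) (at x)"
    and "\<And>x. x \<in> {a<..<b} \<Longrightarrow> norm (f' x) \<le> B"
  shows "norm (f b - f a) \<le> B * (b - a)"
proof (cases "a = b")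
  case False
  have "norm (f b - f a) \<le> B * b - B * a"
  proof (rule differentiable_bound_general[where \<phi> = "\<lambda>x. B * x" and \<phi>' = "\<lambda>_. B"])
    show "((*) B has_vector_derivative B) (at x)" for x
      by (auto intro!: derivative_eq_intros simp flip: has_real_derivative_iff_has_vector_derivative)
  qed (use assms False in \<open>auto intro!: continuous_intros\<close>)
  then show ?thesis by (simp add: algebra_simps)
qed simp

text \<open>A semigroup is given as strongly continuous; a uniform bound turns this pointwise convergence
  into joint continuity in the operator and its argument.\<close>

lemma tendsto_blinfun_apply_strong:
  fixes P :: "'b \<Rightarrow> 'a::real_normed_vector \<Rightarrow>\<^sub>L 'c::real_normed_vector"
  assumes bound: "\<forall>\<^sub>F s in G. norm (P s) \<le> B"
    and P: "((\<lambda>s. P s y) \<longlongrightarrow> l) G" and z: "(z \<longlongrightarrow> y) G"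
  shows "((\<lambda>s. P s (z s)) \<longlongrightarrow> l) G"
proof -
  have "((\<lambda>s. P s (z s - y)) \<longlongrightarrow> 0) G"
  proof (rule Lim_null_comparison)
    show "\<forall>\<^sub>F s in G. norm (P s (z s - y)) \<le> B * norm (z s - y)"
      using bound by eventually_elim
        (meson mult_right_mono norm_blinfun norm_ge_zero order_trans)
    show "((\<lambda>s. B * norm (z s - y)) \<longlongrightarrow> 0) G"
      using z by (intro tendsto_mult_right_zero tendsto_norm_zero) (simp add: LIM_zero_iff)
  qed
  from tendsto_add[OF this P] show ?thesis by (simp add: blinfun.diff_right)
qed

text \<open>The product rule for a strongly differentiable operator family: the difference quotient is
  \<open>P s\<close> applied to the quotient of \<open>w\<close>, plus the quotient of \<open>P\<close> at the fixed vector \<open>w t\<close>.\<close>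

lemma has_vector_derivative_blinfun_apply_strong:
  fixes P :: "real \<Rightarrow> 'a::real_normed_vector \<Rightarrow>\<^sub>L 'b::real_normed_vector"
  assumes bound: "\<forall>\<^sub>F s in at t. norm (P s) \<le> B"
    and cont: "((\<lambda>s. P s w') \<longlongrightarrow> P t w') (at t)"
    and P: "((\<lambda>s. P s (w t)) has_vector_derivative p') (at t)"
    and w: "(w has_vector_derivative w') (at t)"
  shows "((\<lambda>s. P s (w s)) has_vector_derivative P t w' + p') (at t)"
proof -
  have "((\<lambda>s. P s ((w s - w t) /\<^sub>R (s - t)) + (P s (w t) - P t (w t)) /\<^sub>R (s - t))
      \<longlongrightarrow> P t w' + p') (at t)"
    using P w unfolding has_vector_derivative_iff_quotient
    by (intro tendsto_add tendsto_blinfun_apply_strong[OF bound cont])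
  then show ?thesis
    unfolding has_vector_derivative_iff_quotient
    by (rule Lim_transform_eventually)
      (simp add: blinfun.scaleR_right blinfun.diff_right flip: scaleR_add_right)
qed

section \<open>Semigroups on one time step\<close>

text \<open>\<open>h\<close> is the step size. The growth bound with \<open>C\<close> and \<open>\<omega>\<close> ensures that the \<open>\<phi>\<close>-functions are
  given by their integrals, whereas all estimates use the single constant \<open>B\<close>, valid over one
  step.\<close>

locale step_semigroup =
  fixes A :: "'a::banach \<Rightarrow>\<^sub>L 'a" and S :: "real \<Rightarrow> 'a \<Rightarrow>\<^sub>L 'a" and C \<omega> h B :: real
  assumes generates: "generates_C0_semigroup A S"
    and growth: "\<And>t. 0 \<le> t \<Longrightarrow> norm (S t) \<le> C * exp (\<omega> * t)"
    and h_pos: "0 < h"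
    and bound: "\<And>t. 0 \<le> t \<Longrightarrow> t \<le> h \<Longrightarrow> norm (S t) \<le> B"
begin

lemma semigroup: "C0_semigroup S"
  using generates by (simp add: generates_C0_semigroup_def)

lemma S_0: "S 0 x = x"
  using semigroup by (simp add: C0_semigroup_def)

lemma S_add: "0 \<le> s \<Longrightarrow> 0 \<le> t \<Longrightarrow> S (s + t) x = S s (S t x)"
  using semigroup by (simp add: C0_semigroup_def)

lemma continuous_orbit: "continuous_on {0..} (\<lambda>t. S t x)"
  using semigroup by (simp add: C0_semigroup_def)

lemma B_nonneg: "0 \<le> B"
  using bound[of 0] h_pos norm_ge_zero[of "S 0"] by linarith

lemma norm_orbit_le: "0 \<le> t \<Longrightarrow> t \<le> h \<Longrightarrow> norm (S t x) \<le> B * norm x"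
  using bound[of t] norm_blinfun[of "S t" x] by (meson mult_right_mono norm_ge_zero order_trans)

lemma norm_orbit_theta_le:
  assumes "\<theta> \<in> {0..1}"
  shows "norm (S ((1 - \<theta>) * h) x) \<le> B * norm x"
  using assms h_pos by (intro norm_orbit_le) (auto simp: mult_left_le_one_le)

lemma tendsto_orbit:
  assumes "0 < t"
  shows "((\<lambda>s. S s x) \<longlongrightarrow> S t x) (at t)"
  using continuous_on_interior[OF continuous_orbit, of t x] assms
  by (simp add: isCont_def)

text \<open>The generator prescribes only the right derivative at \<open>0\<close>. The right derivative at \<open>t\<close> follows
  by applying \<open>S t\<close>. For the left one, the quotient equals \<open>S (t - k)\<close> applied to
  \<open>(S k x - x) / k\<close>, where operator and argument both vary, so that strong continuity and the
  bound on \<open>S\<close> are combined. Since \<open>A\<close> is everywhere defined, this holds for all \<open>x\<close>.\<close>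

lemma orbit_derivative:
  assumes t: "0 < t" "t < h"
  shows "((\<lambda>s. S s x) has_vector_derivative S t (A x)) (at t)"
proof -
  have q: "((\<lambda>k. (S k x - x) /\<^sub>R k) \<longlongrightarrow> A x) (at_right 0)"
    using generates by (simp add: generates_C0_semigroup_def)
  have "((\<lambda>s. (S s x - S t x) /\<^sub>R (s - t)) \<longlongrightarrow> S t (A x)) (at_right t)"
    unfolding filterlim_at_right_to_0[of _ _ t]
  proof (rule Lim_transform_eventually)
    show "((\<lambda>k. S t ((S k x - x) /\<^sub>R k)) \<longlongrightarrow> S t (A x)) (at_right 0)"
      by (intro tendsto_intros q)
    show "\<forall>\<^sub>F k in at_right 0. S t ((S k x - x) /\<^sub>R k) = (S (k + t) x - S t x) /\<^sub>R (k + t - t)"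
      using eventually_at_right_less[of 0]
    proof eventually_elim
      case (elim k)
      then have "S (k + t) x = S t (S k x)" using S_add[of t k x] t by (simp add: add.commute)
      then show ?case by (simp add: blinfun.scaleR_right blinfun.diff_right)
    qed
  qed
  moreover have "((\<lambda>s. (S s x - S t x) /\<^sub>R (s - t)) \<longlongrightarrow> S t (A x)) (at_left t)"
    unfolding at_left_minus[of t] filterlim_filtermap at_right_to_0[of "-t"]
  proof (rule Lim_transform_eventually)
    have ev: "\<forall>\<^sub>F k in at_right 0. 0 < k \<and> k < t"
      using t eventually_at_right_less[of 0]  eventually_at_right_real[of 0 t] by auto
    show "((\<lambda>k. S (t - k) ((S k x - x) /\<^sub>R k)) \<longlongrightarrow> S t (A x)) (at_right 0)"
    proof (rule tendsto_blinfun_apply_strong[OF _ _ q])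
      show "\<forall>\<^sub>F k in at_right 0. norm (S (t - k)) \<le> B"
        using ev by eventually_elim (use t in \<open>auto intro!: bound\<close>)
      have "isCont (\<lambda>k. S (t - k) (A x)) 0"
        by (rule isCont_o2[where g = "\<lambda>s. S s (A x)"])
          (use t tendsto_orbit in \<open>auto simp: isCont_def intro!: tendsto_eq_intros\<close>)
      then show "((\<lambda>k. S (t - k) (A x)) \<longlongrightarrow> S t (A x)) (at_right 0)"
        by (auto simp: isCont_def intro: tendsto_within_subset)
    qed
    show "\<forall>\<^sub>F k in at_right 0. S (t - k) ((S k x - x) /\<^sub>R k) =
        (S (- (k + - t)) x - S t x) /\<^sub>R (- (k + - t) - t)"
      using ev
    proof eventually_elim
      case (elim k)
      then have "S t x = S (t - k) (S k x)" using S_add[of "t - k" k x] by simp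
      then show ?case
        by (simp add: blinfun.scaleR_right blinfun.diff_right flip: scaleR_minus_right)
    qed
  qed
  ultimately show ?thesis
    unfolding has_vector_derivative_iff_quotient by (simp add: filterlim_at_split)
qed

lemma norm_orbit_increment_le:
  assumes "0 \<le> t" "t \<le> h"
  shows "norm (S t x - x) \<le> B * norm (A x) * t"
proof -
  have "norm (S t x - S 0 x) \<le> B * norm (A x) * (t - 0)"
    by (rule norm_increment_le[where f' = "\<lambda>s. S s (A x)"])
      (use assms in \<open>auto intro!: orbit_derivative norm_orbit_le continuous_on_subset[OF continuous_orbit]\<close>)
  then show ?thesis by (simp add: S_0)
qed

lemma continuous_on_propagated:
  assumes w: "continuous_on {0..1} w"
  shows "continuous_on {0..1} (\<lambda>\<theta>. S ((1 - \<theta>) * h) (w \<theta>))"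
  unfolding continuous_on_def
proof
  fix \<theta> :: real assume \<theta>: "\<theta> \<in> {0..1}"
  have c: "continuous_on {0..1} (\<lambda>s. S ((1 - s) * h) (w \<theta>))"
    by (rule continuous_on_compose2[OF continuous_orbit])
      (use h_pos in \<open>auto intro!: continuous_intros\<close>)
  show "((\<lambda>s. S ((1 - s) * h) (w s)) \<longlongrightarrow> S ((1 - \<theta>) * h) (w \<theta>)) (at \<theta> within {0..1})"
  proof (rule tendsto_blinfun_apply_strong)
    show "\<forall>\<^sub>F s in at \<theta> within {0..1}. norm (S ((1 - s) * h)) \<le> B"
      using h_pos by (auto simp: eventually_at_filter mult_left_le_one_le intro!: bound always_eventually)
  qed (use c w \<theta> in \<open>auto simp: continuous_on_def\<close>)
qed

text \<open>\<open>w\<close> is the solution rescaled to the unit interval. By the product rule, \<open>S ((1 - \<theta>) h) (w \<theta>)\<close>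
  has the derivative \<open>h S ((1 - \<theta>) h) (g \<theta>)\<close>, as the two terms with \<open>A\<close> cancel; the
  fundamental theorem of calculus does the rest. Assuming differentiability in the interior
  lets the step touch the end points of the time interval, where \<open>u\<close> is merely continuous.\<close>

lemma variation_of_constants:
  assumes w: "continuous_on {0..1} w"
    and w': "\<And>\<theta>. \<theta> \<in> {0<..<1} \<Longrightarrow> (w has_vector_derivative h *\<^sub>R (A (w \<theta>) + g \<theta>)) (at \<theta>)"
  shows "((\<lambda>\<theta>. h *\<^sub>R S ((1 - \<theta>) * h) (g \<theta>)) has_integral (w 1 - S h (w 0))) {0..1}"
proof -
  have "((\<lambda>\<theta>. S ((1 - \<theta>) * h) (w \<theta>)) has_vector_derivative h *\<^sub>R S ((1 - \<theta>) * h) (g \<theta>)) (at \<theta>)"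
    if \<theta>: "\<theta> \<in> {0<..<1}" for \<theta>
  proof -
    have t: "0 < (1 - \<theta>) * h" "(1 - \<theta>) * h < h" using \<theta> h_pos by auto
    have lin: "((\<lambda>s. (1 - s) * h) has_vector_derivative - h) (at \<theta>)"
      by (auto intro!: derivative_eq_intros simp flip: has_real_derivative_iff_has_vector_derivative)
    have tend: "((\<lambda>s. (1 - s) * h) \<longlongrightarrow> (1 - \<theta>) * h) (at \<theta>)"
      by (intro tendsto_intros)
    have bd: "\<forall>\<^sub>F s in at \<theta>. norm (S ((1 - s) * h)) \<le> B"
      using order_tendstoD(1)[OF tend t(1)] order_tendstoD(2)[OF tend t(2)]
      by eventually_elim (rule bound; linarith)
    have P: "((\<lambda>s. S ((1 - s) * h) y) has_vector_derivative - h *\<^sub>R S ((1 - \<theta>) * h) (A y)) (at \<theta>)" for y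
      using vector_diff_chain_at[OF lin orbit_derivative[OF t]] by (simp add: o_def)
    have c: "((\<lambda>s. S ((1 - s) * h) y) \<longlongrightarrow> S ((1 - \<theta>) * h) y) (at \<theta>)" for y
      using has_vector_derivative_continuous[OF P] by (simp add: isCont_def)
    show ?thesis
      using has_vector_derivative_blinfun_apply_strong[OF bd c P w'[OF \<theta>]]
      by (simp add: blinfun.scaleR_right blinfun.add_right scaleR_add_right)
  qed
  from fundamental_theorem_of_calculus_interior[OF _ continuous_on_propagated[OF w] this]
  show ?thesis by (simp add: S_0)
qed

lemma has_integral_phi:
  assumes "1 \<le> p"
  shows "((\<lambda>\<theta>. (\<theta> ^ (p - 1) / fact (p - 1)) *\<^sub>R S ((1 - \<theta>) * h) x) has_integral phi S p h x) {0..1}"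
proof -
  have cont: "continuous_on {0..1} (\<lambda>\<theta>::real. (\<theta> ^ (p - 1) / fact (p - 1)) *\<^sub>R S ((1 - \<theta>) * h) x)"
    by (intro continuous_intros continuous_on_propagated) auto
  have eq: "phi S p h x =
      integral {0..1} (\<lambda>\<theta>. (\<theta> ^ (p - 1) / fact (p - 1)) *\<^sub>R S ((1 - \<theta>) * h) x)"
    using growth h_pos assms by (intro blinfun_apply_phi[OF semigroup]) auto
  show ?thesis
    unfolding eq by (rule integrable_integral[OF integrable_continuous_interval[OF cont]])
qed

lemma norm_phi_le:
  assumes "1 \<le> p"
  shows "norm (phi S p h x) \<le> B * norm x"
proof -
  have "norm ((\<theta> ^ (p - 1) / fact (p - 1)) *\<^sub>R S ((1 - \<theta>) * h) x) \<le> B * norm x"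
    if \<theta>: "\<theta> \<in> {0..1}" for \<theta>
  proof -
    have "\<theta> ^ (p - 1) / fact (p - 1) \<le> 1 / 1"
      using \<theta> by (intro frac_le) (auto simp: power_le_one)
    then have "norm ((\<theta> ^ (p - 1) / fact (p - 1)) *\<^sub>R S ((1 - \<theta>) * h) x)
        \<le> 1 * norm (S ((1 - \<theta>) * h) x)"
      unfolding norm_scaleR using \<theta> by (intro mult_right_mono) auto
    then show ?thesis using norm_orbit_theta_le[OF \<theta>, of x] by simp
  qed
  from has_integral_bound[OF _ has_integral_phi[OF assms, unfolded interval_cbox] this[folded interval_cbox]]
  show ?thesis using B_nonneg by simp
qed

text \<open>As \<open>\<integral>\<theta> d\<theta> = 1/2\<close>, the difference is \<open>\<integral>\<theta> (S ((1 - \<theta>) h) x - x) d\<theta>\<close>, and the orbit moves by at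
  most \<open>O(h)\<close>.\<close>

lemma norm_phi_2_minus_half_le: "norm (phi S 2 h x - (1 / 2) *\<^sub>R x) \<le> B * norm (A x) * h"
proof -
  have "((\<lambda>\<theta>::real. \<theta>) has_integral (1 / 2)) {0..1}"
    using ident_has_integral[of 0 "1::real"] by simp
  from has_integral_diff[OF has_integral_phi[of 2 x] has_integral_scaleR_left[OF this, of x]]
  have int: "((\<lambda>\<theta>. \<theta> *\<^sub>R (S ((1 - \<theta>) * h) x - x)) has_integral (phi S 2 h x - (1 / 2) *\<^sub>R x)) (cbox 0 1)"
    by (simp add: scaleR_diff_right)
  have "norm (\<theta> *\<^sub>R (S ((1 - \<theta>) * h) x - x)) \<le> B * norm (A x) * h" if \<theta>: "\<theta> \<in> cbox 0 1" for \<theta>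
  proof -
    have "norm (S ((1 - \<theta>) * h) x - x) \<le> B * norm (A x) * ((1 - \<theta>) * h)"
      using \<theta> h_pos by (intro norm_orbit_increment_le) (auto simp: mult_left_le_one_le)
    also have "\<dots> \<le> B * norm (A x) * h"
      using \<theta> h_pos B_nonneg by (intro mult_left_mono) (auto simp: mult_left_le_one_le)
    finally have le: "norm (S ((1 - \<theta>) * h) x - x) \<le> B * norm (A x) * h" .
    have "norm (\<theta> *\<^sub>R (S ((1 - \<theta>) * h) x - x)) \<le> 1 * norm (S ((1 - \<theta>) * h) x - x)"
      unfolding norm_scaleR using \<theta> by (intro mult_right_mono) auto
    with le show ?thesis by simp
  qed
  from has_integral_bound[OF _ int this] show ?thesis
    using B_nonneg h_pos by simp
qed

text \<open>The order conditions at work. The constant \<open>g0\<close> is integrated exactly by \<open>\<phi>\<^sub>1\<close>, the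
  quadratic term \<open>(\<theta>\<^sup>2/2) y\<close> exactly by \<open>\<phi>\<^sub>3\<close>, and \<open>8 d\<close> reproduces \<open>y\<close> up to \<open>8 E\<close>; together with the
  remainder \<open>E\<close> of the integrand this makes \<open>9 E\<close>.\<close>

lemma exponential_quadrature_error:
  assumes int: "((\<lambda>\<theta>. h *\<^sub>R S ((1 - \<theta>) * h) (g \<theta>)) has_integral I) {0..1}"
    and g: "\<And>\<theta>. \<theta> \<in> {0..1} \<Longrightarrow> norm (g \<theta> - g0 - (\<theta>\<^sup>2 / 2) *\<^sub>R y) \<le> E"
    and d: "norm (d - (1 / 8) *\<^sub>R y) \<le> E"
  shows "norm (h *\<^sub>R phi S 1 h g0 + h *\<^sub>R 8 *\<^sub>R phi S 3 h d - I) \<le> 9 * B * E * h"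
proof -
  define R where "R = I - h *\<^sub>R phi S 1 h g0 - h *\<^sub>R phi S 3 h y"
  have "((\<lambda>\<theta>. h *\<^sub>R S ((1 - \<theta>) * h) (g \<theta>) - h *\<^sub>R S ((1 - \<theta>) * h) g0
      - h *\<^sub>R (\<theta>\<^sup>2 / 2) *\<^sub>R S ((1 - \<theta>) * h) y) has_integral R) {0..1}"
    unfolding R_def using has_integral_phi[of 1 g0] has_integral_phi[of 3 y]
    by (intro has_integral_diff int has_integral_cmul) (auto simp: fact_numeral)
  also have "(\<lambda>\<theta>. h *\<^sub>R S ((1 - \<theta>) * h) (g \<theta>) - h *\<^sub>R S ((1 - \<theta>) * h) g0
      - h *\<^sub>R (\<theta>\<^sup>2 / 2) *\<^sub>R S ((1 - \<theta>) * h) y) =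
    (\<lambda>\<theta>. h *\<^sub>R S ((1 - \<theta>) * h) (g \<theta> - g0 - (\<theta>\<^sup>2 / 2) *\<^sub>R y))"
    by (simp add: blinfun.diff_right blinfun.scaleR_right scaleR_diff_right)
  finally have R: "(\<dots> has_integral R) (cbox 0 1)" by simp
  have "E \<ge> 0" using d norm_ge_zero order_trans by blast
  have "norm (h *\<^sub>R S ((1 - \<theta>) * h) (g \<theta> - g0 - (\<theta>\<^sup>2 / 2) *\<^sub>R y)) \<le> h * (B * E)"
    if \<theta>: "\<theta> \<in> cbox 0 1" for \<theta>
  proof -
    have "norm (S ((1 - \<theta>) * h) (g \<theta> - g0 - (\<theta>\<^sup>2 / 2) *\<^sub>R y)) \<le> B * E"
      using norm_orbit_theta_le[of \<theta> "g \<theta> - g0 - (\<theta>\<^sup>2 / 2) *\<^sub>R y"] g[of \<theta>] \<theta> B_nonneg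
      by (simp add: order_trans[OF _ mult_left_mono])
    then show ?thesis using h_pos by simp
  qed
  from has_integral_bound[OF _ R this] have nR: "norm R \<le> h * (B * E)"
    using B_nonneg h_pos \<open>E \<ge> 0\<close> by simp
  have "norm (phi S 3 h (d - (1 / 8) *\<^sub>R y)) \<le> B * E"
    using norm_phi_le[of 3 "d - (1 / 8) *\<^sub>R y"] d B_nonneg
    by (simp add: order_trans[OF _ mult_left_mono])
  then have nd: "norm ((8 * h) *\<^sub>R phi S 3 h (d - (1 / 8) *\<^sub>R y)) \<le> 8 * h * (B * E)"
    using h_pos by simp
  have "h *\<^sub>R phi S 1 h g0 + h *\<^sub>R 8 *\<^sub>R phi S 3 h d - I
      = (8 * h) *\<^sub>R phi S 3 h (d - (1 / 8) *\<^sub>R y) - R"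
    by (simp add: R_def blinfun.diff_right blinfun.scaleR_right scaleR_diff_right mult.commute)
  also have "norm \<dots> \<le> 8 * h * (B * E) + h * (B * E)"
    using norm_triangle_ineq4[of "(8 * h) *\<^sub>R phi S 3 h (d - (1 / 8) *\<^sub>R y)" R] nR nd by linarith
  finally show ?thesis by (simp add: algebra_simps)
qed

end

section \<open>Taylor expansion of the nonlinearity\<close>

text \<open>Along the segment \<open>s \<mapsto> v + s d\<close> everything is a function of one real variable. The bound on
  \<open>F3\<close> is integrated three times: to \<open>F2\<close>, then to \<open>J\<close>, then to \<open>F\<close>. On the segment both
  arguments of \<open>F2 v\<close> are the same \<open>d\<close>, so that \<open>(s\<^sup>2/2) F2 v d d\<close> has the derivative
  \<open>s F2 v d d\<close>, which matches the expansion of \<open>J\<close>.\<close>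

lemma norm_nonlin_taylor_le:
  fixes F :: "'a::banach \<Rightarrow> 'a"
  assumes F: "\<And>w. w \<in> ball v r \<Longrightarrow> (F has_derivative blinfun_apply (J w)) (at w)"
    and J: "\<And>w. w \<in> ball v r \<Longrightarrow> (J has_derivative blinfun_apply (F2 w)) (at w)"
    and F2: "\<And>w. w \<in> ball v r \<Longrightarrow> (F2 has_derivative blinfun_apply (F3 w)) (at w)"
    and F3: "\<And>w. w \<in> ball v r \<Longrightarrow> norm (F3 w) \<le> M"
    and d: "norm d < r"
  shows "norm (nonlin F J v (v + d) - nonlin F J v v - (1 / 2) *\<^sub>R F2 v d d) \<le> M * norm d ^ 3"
proof -
  have "0 < r" using d norm_ge_zero[of d] by linarith
  then have M: "0 \<le> M" using F3[of v] norm_ge_zero[of "F3 v"] by (simp del: norm_ge_zero)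
  have seg: "v + s *\<^sub>R d \<in> ball v r" "norm (s *\<^sub>R d) \<le> norm d" if "s \<in> {0..1}" for s
  proof -
    show le: "norm (s *\<^sub>R d) \<le> norm d"
      using that by (simp add: mult_left_le_one_le)
    then show "v + s *\<^sub>R d \<in> ball v r" using d by (simp add: dist_norm)
  qed
  have curve: "((\<lambda>s. G (v + s *\<^sub>R d)) has_vector_derivative G' d) (at s)"
    if "(G has_derivative G') (at (v + s *\<^sub>R d))" for G :: "'a \<Rightarrow> 'b::real_normed_vector" and G' s
  proof -
    have "((\<lambda>s. v + s *\<^sub>R d) has_derivative (\<lambda>k. k *\<^sub>R d)) (at s)"
      by (auto intro!: derivative_eq_intros)
    from diff_chain_at[OF this that] have "((\<lambda>s. G (v + s *\<^sub>R d)) has_derivative (\<lambda>k. G' (k *\<^sub>R d))) (at s)"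
      by (simp add: o_def)
    then show ?thesis
      using linear_scale[OF has_derivative_linear[OF that]]
      by (simp add: has_vector_derivative_def)
  qed
  have c2: "((\<lambda>s. F2 (v + s *\<^sub>R d)) has_vector_derivative F3 (v + s *\<^sub>R d) d) (at s)" if "s \<in> {0..1}" for s
    by (rule curve[OF F2[OF seg(1)[OF that]]])
  have c1: "((\<lambda>s. J (v + s *\<^sub>R d) - s *\<^sub>R F2 v d) has_vector_derivative F2 (v + s *\<^sub>R d) d - F2 v d) (at s)"
    if "s \<in> {0..1}" for s
    by (rule has_vector_derivative_diff[OF curve[OF J[OF seg(1)[OF that]]]])
      (auto intro!: derivative_eq_intros simp: has_vector_derivative_def)
  have c0: "((\<lambda>s. F (v + s *\<^sub>R d) - s *\<^sub>R J v d - (s\<^sup>2 / 2) *\<^sub>R F2 v d d)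
      has_vector_derivative J (v + s *\<^sub>R d) d - J v d - s *\<^sub>R F2 v d d) (at s)"
    if "s \<in> {0..1}" for s
    by (intro has_vector_derivative_diff curve[OF F[OF seg(1)[OF that]]])
      (auto intro!: derivative_eq_intros simp: has_vector_derivative_def algebra_simps)
  have cont: "continuous_on {a..b} f" if "\<And>s. s \<in> {0..1} \<Longrightarrow> (f has_vector_derivative f' s) (at s)" "{a..b} \<subseteq> {0..1}"
    for f :: "real \<Rightarrow> 'b::real_normed_vector" and f' a b
    using that by (intro continuous_at_imp_continuous_on ballI has_vector_derivative_continuous) blast
  have b2: "norm (F2 (v + s *\<^sub>R d) - F2 v) \<le> M * norm d" if s: "s \<in> {0..1}" for s
  proof -
    have "norm (F2 (v + s *\<^sub>R d) - F2 (v + 0 *\<^sub>R d)) \<le> (M * norm d) * (s - 0)"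
    proof (rule norm_increment_le[OF _ cont[OF c2] c2])
      fix x assume "x \<in> {0<..<s}"
      then have "norm (F3 (v + x *\<^sub>R d)) \<le> M" using s by (intro F3 seg) auto
      then show "norm (F3 (v + x *\<^sub>R d) d) \<le> M * norm d"
        by (meson mult_right_mono norm_blinfun norm_ge_zero order_trans)
    qed (use s in auto)
    also have "\<dots> \<le> M * norm d" using s M by (simp add: mult_left_le)
    finally show ?thesis by simp
  qed
  have b1: "norm (J (v + s *\<^sub>R d) - J v - s *\<^sub>R F2 v d) \<le> M * norm d * norm d" if s: "s \<in> {0..1}" for s
  proof -
    have "norm (J (v + s *\<^sub>R d) - s *\<^sub>R F2 v d - (J (v + 0 *\<^sub>R d) - 0 *\<^sub>R F2 v d))
        \<le> (M * norm d * norm d) * (s - 0)"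
    proof (rule norm_increment_le[OF _ cont[OF c1] c1])
      fix x assume "x \<in> {0<..<s}"
      then have "norm (F2 (v + x *\<^sub>R d) - F2 v) \<le> M * norm d" using s by (intro b2) auto
      then show "norm (F2 (v + x *\<^sub>R d) d - F2 v d) \<le> M * norm d * norm d"
        unfolding blinfun.diff_left[symmetric]
        by (meson mult_right_mono norm_blinfun norm_ge_zero order_trans)
    qed (use s in auto)
    also have "\<dots> \<le> M * norm d * norm d" using s M by (simp add: mult_left_le)
    finally show ?thesis by (simp add: algebra_simps)
  qed
  have "norm (F (v + 1 *\<^sub>R d) - 1 *\<^sub>R J v d - (1\<^sup>2 / 2) *\<^sub>R F2 v d d
      - (F (v + 0 *\<^sub>R d) - 0 *\<^sub>R J v d - (0\<^sup>2 / 2) *\<^sub>R F2 v d d)) \<le> (M * norm d * norm d * norm d) * (1 - 0)"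
  proof (rule norm_increment_le[OF _ cont[OF c0] c0])
    fix x :: real assume "x \<in> {0<..<1}"
    then have "norm (J (v + x *\<^sub>R d) - J v - x *\<^sub>R F2 v d) \<le> M * norm d * norm d" by (intro b1) auto
    then show "norm (J (v + x *\<^sub>R d) d - J v d - x *\<^sub>R F2 v d d) \<le> M * norm d * norm d * norm d"
      unfolding blinfun.diff_left[symmetric] blinfun.scaleR_left[symmetric]
      by (meson mult_right_mono norm_blinfun norm_ge_zero order_trans)
  qed auto
  then show ?thesis
    by (simp add: nonlin_def blinfun.add_right power3_eq_cube mult.assoc algebra_simps)
qed

lemma norm_quadratic_form_diff_le:
  fixes Q :: "'a::real_normed_vector \<Rightarrow>\<^sub>L 'a \<Rightarrow>\<^sub>L 'b::real_normed_vector"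
  assumes Q: "norm Q \<le> M" and d: "norm d \<le> D" and y: "norm y \<le> D" and e: "norm (d - y) \<le> E"
  shows "norm (Q d d - Q y y) \<le> 2 * (M * D * E)"
proof -
  have D: "0 \<le> D" using d norm_ge_zero order_trans by blast
  have M: "0 \<le> M" using Q norm_ge_zero order_trans by blast
  have Qb: "norm (Q a b) \<le> M * norm a * norm b" for a b
    by (meson Q mult_right_mono norm_blinfun norm_ge_zero order_trans)
  have "Q d d - Q y y = Q (d - y) d + Q y (d - y)"
    by (simp add: blinfun.diff_right blinfun.diff_left)
  also have "norm \<dots> \<le> M * norm (d - y) * norm d + M * norm y * norm (d - y)"
    by (intro norm_triangle_mono Qb)
  also have "\<dots> \<le> M * E * D + M * D * E"
    by (intro add_mono mult_mono mult_nonneg_nonneg d y e M D) (use e norm_ge_zero order_trans in blast)+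
  finally show ?thesis by (simp add: mult_ac)
qed

text \<open>Replacing \<open>d\<close> by an approximation \<open>y\<close> inside the quadratic term. With \<open>D = O(h)\<close> and
  \<open>E = O(h\<^sup>2)\<close> the bound is \<open>O(h\<^sup>3)\<close>.\<close>

lemma norm_nonlin_along_tangent_le:
  fixes F :: "'a::banach \<Rightarrow> 'a"
  assumes F: "\<And>w. w \<in> ball v r \<Longrightarrow> (F has_derivative blinfun_apply (J w)) (at w)"
    and J: "\<And>w. w \<in> ball v r \<Longrightarrow> (J has_derivative blinfun_apply (F2 w)) (at w)"
    and F2: "\<And>w. w \<in> ball v r \<Longrightarrow> (F2 has_derivative blinfun_apply (F3 w)) (at w)"
    and M: "\<And>w. w \<in> ball v r \<Longrightarrow> norm (F2 w) \<le> M \<and> norm (F3 w) \<le> M"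
    and small: "D < r" and d: "norm d \<le> D" and y: "norm y \<le> D" and e: "norm (d - y) \<le> E"
  shows "norm (nonlin F J v (v + d) - nonlin F J v v - (1 / 2) *\<^sub>R F2 v y y) \<le> M * D ^ 3 + M * D * E"
proof -
  have "0 < r" using small d norm_ge_zero[of d] by linarith
  then have F2v: "norm (F2 v) \<le> M" using M[of v] by simp
  then have M0: "0 \<le> M" using norm_ge_zero order_trans by blast
  have "norm (nonlin F J v (v + d) - nonlin F J v v - (1 / 2) *\<^sub>R F2 v d d) \<le> M * norm d ^ 3"
    using M small d by (intro norm_nonlin_taylor_le[OF F J F2]) auto
  also have "\<dots> \<le> M * D ^ 3"
    by (intro mult_left_mono power_mono d M0) auto
  finally have 1: "norm (nonlin F J v (v + d) - nonlin F J v v - (1 / 2) *\<^sub>R F2 v d d) \<le> M * D ^ 3" .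
  have 2: "norm ((1 / 2) *\<^sub>R (F2 v d d - F2 v y y)) \<le> M * D * E"
    using norm_quadratic_form_diff_le[OF F2v d y e] by simp
  have "nonlin F J v (v + d) - nonlin F J v v - (1 / 2) *\<^sub>R F2 v y y =
     (nonlin F J v (v + d) - nonlin F J v v - (1 / 2) *\<^sub>R F2 v d d) + (1 / 2) *\<^sub>R (F2 v d d - F2 v y y)"
    by (simp add: scaleR_diff_right)
  also have "norm \<dots> \<le> M * D ^ 3 + M * D * E"
    by (rule norm_triangle_mono[OF 1 2])
  finally show ?thesis .
qed

section \<open>The local error\<close>

text \<open>The error of one step with an explicit constant; \<open>w \<theta>\<close> stands for \<open>u (t + \<theta> h)\<close>. The smallness
  condition keeps both the exact solution and the stage in the ball on which \<open>F\<close> is smooth.\<close>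

lemma (in step_semigroup) norm_dpg_step_error_le:
  fixes F :: "'a \<Rightarrow> 'a"
  assumes A: "J v = A" and S: "SS v = S"
    and F: "\<And>x. x \<in> ball v r \<Longrightarrow> (F has_derivative blinfun_apply (J x)) (at x)"
    and J: "\<And>x. x \<in> ball v r \<Longrightarrow> (J has_derivative blinfun_apply (F2 x)) (at x)"
    and F2: "\<And>x. x \<in> ball v r \<Longrightarrow> (F2 has_derivative blinfun_apply (F3 x)) (at x)"
    and M: "\<And>x. x \<in> ball v r \<Longrightarrow> norm (J x) \<le> M \<and> norm (F2 x) \<le> M \<and> norm (F3 x) \<le> M"
    and b1: "b1 (h *\<^sub>R A) + b2 (h *\<^sub>R A) = phi S 1 h"
    and b2: "(1 / 8) *\<^sub>R b2 (h *\<^sub>R A) = phi S 3 h"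
    and w: "continuous_on {0..1} w" and w0: "w 0 = v"
    and w': "\<And>\<theta>. \<theta> \<in> {0<..<1} \<Longrightarrow> (w has_vector_derivative h *\<^sub>R F (w \<theta>)) (at \<theta>)"
    and P: "\<And>\<theta>. \<theta> \<in> {0..1} \<Longrightarrow> norm (F (w \<theta>)) \<le> P"
    and B1: "1 \<le> B" and small: "B * P * h < r"
  shows "norm (dpg_step b1 b2 F J SS h v - w 1) \<le> 9 * B * (M * (B * P) ^ 3 + M * (B * P) * (B * M * P)) * h ^ 4"
proof -
  define f where "f = F v"
  \<comment> \<open>Common bounds for the solution and the stage: \<open>D\<close> for the distance from \<open>v\<close>, \<open>E\<close> for the
    distance from the tangent. The factor \<open>B\<close> comes from the norm of \<open>\<phi>\<^sub>2\<close> in the stage.\<close>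
  define D where "D = B * P * h"
  define E where "E = B * M * P * h\<^sup>2"
  define q where "q = h\<^sup>2 *\<^sub>R F2 v f f"
  have nf: "norm f \<le> P" using P[of 0] by (simp add: f_def w0)
  then have P0: "0 \<le> P" using norm_ge_zero order_trans by blast
  have PhD: "P * h \<le> D" using mult_right_mono[OF B1, of "P * h"] P0 h_pos by (simp add: D_def)
  have D0: "0 \<le> D" unfolding D_def using P0 h_pos B1 by simp
  have v: "v \<in> ball v r" using small D0 by (simp add: D_def)
  have M0: "0 \<le> M" using M[OF v] norm_ge_zero order_trans by blast
  have MPhE: "M * P * h\<^sup>2 \<le> E"
    using mult_right_mono[OF B1, of "M * P * h\<^sup>2"] P0 M0 by (simp add: E_def mult_ac)
  note tangent = norm_nonlin_along_tangent_le[of v r F J F2 F3 M D, OF F J F2 _ small[folded D_def]]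
  have near: "norm (w \<theta> - v) \<le> P * h" if \<theta>: "\<theta> \<in> {0..1}" for \<theta>
  proof -
    have "norm (w \<theta> - w 0) \<le> (P * h) * (\<theta> - 0)"
    proof (rule norm_increment_le[OF _ _ w'])
      fix x assume "x \<in> {0<..<\<theta>}"
      then show "norm (h *\<^sub>R F (w x)) \<le> P * h" using P[of x] \<theta> h_pos by (simp add: mult.commute)
    qed (use \<theta> in \<open>auto intro: continuous_on_subset[OF w]\<close>)
    also have "\<dots> \<le> P * h" using \<theta> P0 h_pos by (simp add: mult_left_le)
    finally show ?thesis by (simp add: w0)
  qed
  \<comment> \<open>So \<open>w'\<close> deviates from \<open>h f\<close> by \<open>O(h\<^sup>2)\<close>, which is what keeps \<open>w\<close> close to its tangent.\<close>
  have F_lip: "norm (F (w \<theta>) - f) \<le> M * (P * h)" if \<theta>: "\<theta> \<in> {0..1}" for \<theta>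
  proof -
    have "w \<theta> \<in> ball v r"
      using near[OF \<theta>] PhD small by (simp add: D_def dist_norm norm_minus_commute)
    then have "norm (F (w \<theta>) - F v) \<le> M * norm (w \<theta> - v)"
      using F M v by (intro differentiable_bound[where S = "ball v r" and f' = "\<lambda>x. blinfun_apply (J x)"])
        (auto intro: has_derivative_at_withinI simp flip: norm_blinfun.rep_eq)
    also have "\<dots> \<le> M * (P * h)" by (rule mult_left_mono[OF near[OF \<theta>] M0])
    finally show ?thesis by (simp add: f_def)
  qed
  have exact: "norm (w \<theta> - v - (\<theta> * h) *\<^sub>R f) \<le> E" if \<theta>: "\<theta> \<in> {0..1}" for \<theta>
  proof -
    have "norm ((w \<theta> - \<theta> *\<^sub>R (h *\<^sub>R f)) - (w 0 - 0 *\<^sub>R (h *\<^sub>R f))) \<le> (M * P * h\<^sup>2) * (\<theta> - 0)"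
    proof (rule norm_increment_le)
      fix x assume x: "x \<in> {0<..<\<theta>}"
      then show "((\<lambda>x. w x - x *\<^sub>R (h *\<^sub>R f)) has_vector_derivative h *\<^sub>R F (w x) - h *\<^sub>R f) (at x)"
        using \<theta> by (intro has_vector_derivative_diff w')
          (auto intro!: derivative_eq_intros simp: has_vector_derivative_def)
      show "norm (h *\<^sub>R F (w x) - h *\<^sub>R f) \<le> M * P * h\<^sup>2"
        using mult_left_mono[OF F_lip[of x], of h] x \<theta> h_pos
        by (simp add: power2_eq_square mult_ac flip: scaleR_diff_right)
    qed (use \<theta> in \<open>auto intro!: continuous_intros intro: continuous_on_subset[OF w]\<close>)
    also have "\<dots> \<le> M * P * h\<^sup>2" using \<theta> P0 M0 by (simp add: mult_left_le)
    finally show ?thesis using MPhE by (simp add: w0 algebra_simps)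
  qed
  have g: "norm (nonlin F J v (w \<theta>) - nonlin F J v v - (\<theta>\<^sup>2 / 2) *\<^sub>R q) \<le> M * D ^ 3 + M * D * E"
    if \<theta>: "\<theta> \<in> {0..1}" for \<theta>
  proof -
    have "norm ((\<theta> * h) *\<^sub>R f) \<le> h * P"
      unfolding norm_scaleR using \<theta> nf h_pos by (intro mult_mono) (auto simp: mult_left_le_one_le)
    then have "norm ((\<theta> * h) *\<^sub>R f) \<le> D" using PhD by (simp add: mult.commute)
    from tangent[OF _ _ _ _ order_trans[OF near[OF \<theta>] PhD] this exact[OF \<theta>]] M
    show ?thesis
      by (simp add: q_def blinfun.scaleR_left blinfun.scaleR_right power2_eq_square mult_ac)
  qed
  \<comment> \<open>The stage starts from \<open>g v + A v = f\<close>, hence moves along the tangent by about \<open>h/2\<close>.\<close>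
  define z where "z = dpg_stage F J SS h v - v"
  have z: "z = h *\<^sub>R phi S 2 h f"
    by (simp add: z_def dpg_stage_def nonlin_def f_def S)
  have "norm (phi S 2 h f) \<le> B * P"
    using norm_phi_le[of 2 f] mult_left_mono[OF nf B_nonneg] by simp
  then have zD: "norm z \<le> D"
    using mult_left_mono[of "norm (phi S 2 h f)" "B * P" h] h_pos by (simp add: z D_def mult_ac)
  have "norm (A f) \<le> M * P"
    using norm_blinfun[of A f] M[OF v] nf M0 A by (meson mult_mono norm_ge_zero order_trans)
  then have "B * norm (A f) * h \<le> B * (M * P) * h"
    using B_nonneg h_pos by (intro mult_right_mono mult_left_mono) auto
  then have "norm (phi S 2 h f - (1 / 2) *\<^sub>R f) \<le> B * (M * P) * h"
    using norm_phi_2_minus_half_le[of f] by linarith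
  then have "h * norm (phi S 2 h f - (1 / 2) *\<^sub>R f) \<le> E"
    using mult_left_mono[of _ "B * (M * P) * h" h] h_pos
    by (simp add: E_def power2_eq_square mult_ac)
  moreover have "z - (h / 2) *\<^sub>R f = h *\<^sub>R (phi S 2 h f - (1 / 2) *\<^sub>R f)"
    by (simp add: z scaleR_diff_right)
  ultimately have zE: "norm (z - (h / 2) *\<^sub>R f) \<le> E" using h_pos by simp
  have "norm ((h / 2) *\<^sub>R f) \<le> h * P"
    unfolding norm_scaleR using nf h_pos by (intro mult_mono) auto
  then have "norm ((h / 2) *\<^sub>R f) \<le> D" using PhD by (simp add: mult.commute)
  from tangent[OF _ _ _ _ zD this zE] M
  have stage: "norm (nonlin F J v (v + z) - nonlin F J v v - (1 / 8) *\<^sub>R q) \<le> M * D ^ 3 + M * D * E"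
    by (simp add: q_def blinfun.scaleR_left blinfun.scaleR_right power2_eq_square mult_ac)
  have "((\<lambda>\<theta>. h *\<^sub>R S ((1 - \<theta>) * h) (nonlin F J v (w \<theta>))) has_integral w 1 - S h (w 0)) {0..1}"
    by (rule variation_of_constants[OF w]) (use w' in \<open>simp add: nonlin_def A\<close>)
  from exponential_quadrature_error[OF this g stage]
  have "norm (h *\<^sub>R phi S 1 h (nonlin F J v v)
      + h *\<^sub>R 8 *\<^sub>R phi S 3 h (nonlin F J v (v + z) - nonlin F J v v) - (w 1 - S h (w 0)))
      \<le> 9 * B * (M * D ^ 3 + M * D * E) * h" .
  moreover have "dpg_step b1 b2 F J SS h v - w 1 = h *\<^sub>R phi S 1 h (nonlin F J v v)
      + h *\<^sub>R 8 *\<^sub>R phi S 3 h (nonlin F J v (v + z) - nonlin F J v v) - (w 1 - S h (w 0))"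
  proof -
    have "b2 (h *\<^sub>R A) = 8 *\<^sub>R phi S 3 h" by (simp flip: b2)
    moreover from this have "b1 (h *\<^sub>R A) = phi S 1 h - 8 *\<^sub>R phi S 3 h"
      using b1 by (simp add: eq_diff_eq)
    ultimately show ?thesis
      by (simp add: dpg_step_def A S w0 z_def blinfun.diff_left blinfun.scaleR_left blinfun.diff_right
          scaleR_diff_right)
  qed
  moreover have "9 * B * (M * D ^ 3 + M * D * E) * h
      = 9 * B * (M * (B * P) ^ 3 + M * (B * P) * (B * M * P)) * h ^ 4"
    by (simp add: D_def E_def power_mult_distrib algebra_simps power2_eq_square power3_eq_cube power4_eq_xxxx)
  ultimately show ?thesis by (simp only:)
qed

theorem theorem1:
  fixes F :: "'a::banach \<Rightarrow> 'a"
    and J :: "'a \<Rightarrow> 'a \<Rightarrow>\<^sub>L 'a"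
    and F2 :: "'a \<Rightarrow> 'a \<Rightarrow>\<^sub>L 'a \<Rightarrow>\<^sub>L 'a"
    and F3 :: "'a \<Rightarrow> 'a \<Rightarrow>\<^sub>L 'a \<Rightarrow>\<^sub>L 'a \<Rightarrow>\<^sub>L 'a"
    and S :: "'a \<Rightarrow> real \<Rightarrow> 'a \<Rightarrow>\<^sub>L 'a"
    and b1 b2 :: "('a \<Rightarrow>\<^sub>L 'a) \<Rightarrow> 'a \<Rightarrow>\<^sub>L 'a"
    and u :: "real \<Rightarrow> 'a" and u0 :: 'a
    and T r M C \<omega> :: real
  assumes "T > 0"
    and "continuous_on {0..T} u"
    and "u C1_differentiable_on {0<..<T}"
    and "\<And>t. t \<in> {0<..<T} \<Longrightarrow> (u has_vector_derivative F (u t)) (at t)"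
    and "u 0 = u0"
    and "r > 0"
    and "\<And>v. v \<in> strip u T r \<Longrightarrow> (F has_derivative blinfun_apply (J v)) (at v)"
    and "\<And>v. v \<in> strip u T r \<Longrightarrow> (J has_derivative blinfun_apply (F2 v)) (at v)"
    and "\<And>v. v \<in> strip u T r \<Longrightarrow> (F2 has_derivative blinfun_apply (F3 v)) (at v)"
    and "\<And>v. v \<in> strip u T r \<Longrightarrow> norm (J v) \<le> M \<and> norm (F2 v) \<le> M \<and> norm (F3 v) \<le> M"
    and "\<And>v. v \<in> strip u T r \<Longrightarrow> generates_C0_semigroup (J v) (S v)"
    and "\<And>v t. v \<in> strip u T r \<Longrightarrow> t \<ge> 0 \<Longrightarrow> norm (S v t) \<le> C * exp (\<omega> * t)"
    and "\<And>v h. v \<in> strip u T r \<Longrightarrow> h > 0 \<Longrightarrow>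
           b1 (h *\<^sub>R J v) + b2 (h *\<^sub>R J v) = phi (S v) 1 h"
    and "\<And>v h. v \<in> strip u T r \<Longrightarrow> h > 0 \<Longrightarrow>
           (1 / 8) *\<^sub>R b2 (h *\<^sub>R J v) = phi (S v) 3 h"
  shows "\<exists>K. \<forall>\<^sub>F N in sequentially. \<forall>n<N.
           norm (local_error b1 b2 F J S u T N n) \<le> K * (T / real N) ^ 4"
proof -
  have T: "0 < T" and u: "continuous_on {0..T} u" and r: "0 < r" by fact+
  note u' = assms(4) and F = assms(7) and J = assms(8) and F2 = assms(9) and bounds = assms(10)
    and gen = assms(11) and growth = assms(12) and b1 = assms(13) and b2 = assms(14)
  have ball: "ball (u t) r \<subseteq> strip u T r" if "t \<in> {0..T}" for t
    using that by (auto simp: strip_def)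
  then have on_strip: "u t \<in> strip u T r" if "t \<in> {0..T}" for t
    using that r by (meson centre_in_ball subsetD)
  have "continuous_on (strip u T r) F"
    by (intro continuous_at_imp_continuous_on ballI has_derivative_continuous[OF F])
  then have "continuous_on {0..T} (\<lambda>t. F (u t))"
    by (rule continuous_on_compose2[OF _ u]) (use on_strip in auto)
  then have "bounded ((\<lambda>t. F (u t)) ` {0..T})"
    by (intro compact_imp_bounded compact_continuous_image) auto
  then obtain P where P: "\<And>t. t \<in> {0..T} \<Longrightarrow> norm (F (u t)) \<le> P"
    unfolding bounded_iff by blast
  \<comment> \<open>The summand \<open>1\<close> provides \<open>1 \<le> B\<close>; the absolute values allow for negative \<open>\<omega>\<close>.\<close>
  define B where "B = 1 + \<bar>C\<bar> * exp (\<bar>\<omega>\<bar> * T)"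
  have B: "norm (S v s) \<le> B" if "v \<in> strip u T r" "0 \<le> s" "s \<le> T" for v s
  proof -
    have "\<omega> * s \<le> \<bar>\<omega>\<bar> * T" by (rule mult_mono) (use that in auto)
    then have "C * exp (\<omega> * s) \<le> \<bar>C\<bar> * exp (\<bar>\<omega>\<bar> * T)" by (intro mult_mono) auto
    then show ?thesis using growth[OF that(1,2)] by (simp add: B_def)
  qed
  define K where "K = 9 * B * (M * (B * P) ^ 3 + M * (B * P) * (B * M * P))"
  have "(\<lambda>N. B * P * (T / real N)) \<longlonglongrightarrow> 0"
    by (intro tendsto_mult_right_zero lim_const_over_n)
  then have "\<forall>\<^sub>F N in sequentially. B * P * (T / real N) < r"
    using r by (rule order_tendstoD)
  then have "\<forall>\<^sub>F N in sequentially. \<forall>n<N.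
      norm (local_error b1 b2 F J S u T N n) \<le> K * (T / real N) ^ 4"
  proof (eventually_elim, intro allI impI)
    fix N n :: nat assume small: "B * P * (T / real N) < r" and n: "n < N"
    define h where "h = T / real N"
    define t where "t = grid T N n"
    have h: "0 < h" using T n by (simp add: h_def)
    have Nh: "real N * h = T" using n by (simp add: h_def)
    have next_t: "grid T N (Suc n) = t + h" unfolding grid_def t_def h_def[symmetric] by (simp add: algebra_simps)
    have t0: "0 \<le> t" using h by (simp add: t_def grid_def flip: h_def)
    have "real (Suc n) * h \<le> real N * h" using n h by (intro mult_right_mono) auto
    then have tT: "t + h \<le> T" using Nh by (simp add: t_def grid_def algebra_simps flip: h_def)
    have inside: "t + \<theta> * h \<in> {0..T}" if "\<theta> \<in> {0..1}" for \<theta>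
    proof -
      have "0 \<le> \<theta> * h" "\<theta> * h \<le> h" using that h by (auto simp: mult_left_le_one_le)
      then show ?thesis using t0 tT by simp
    qed
    have t: "t \<in> {0..T}" using t0 tT h by simp
    interpret step_semigroup "J (u t)" "S (u t)" C \<omega> h B
      by unfold_locales (use gen growth on_strip[OF t] B h t0 tT in auto)
    have "norm (dpg_step b1 b2 F J S h (u t) - u (t + 1 * h)) \<le> K * h ^ 4"
      unfolding K_def
    proof (rule norm_dpg_step_error_le[where w = "\<lambda>\<theta>. u (t + \<theta> * h)" and r = r and ?F2.0 = F2 and ?F3.0 = F3])
      show "continuous_on {0..1} (\<lambda>\<theta>. u (t + \<theta> * h))"
        by (rule continuous_on_compose2[OF u]) (use inside in \<open>auto intro!: continuous_intros\<close>)
      show "((\<lambda>\<theta>. u (t + \<theta> * h)) has_vector_derivative h *\<^sub>R F (u (t + \<theta> * h))) (at \<theta>)"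
        if \<theta>: "\<theta> \<in> {0<..<1}" for \<theta>
      proof -
        have "0 < \<theta> * h" "\<theta> * h < h" using \<theta> h by auto
        then have "(u has_vector_derivative F (u (t + \<theta> * h))) (at (t + \<theta> * h))"
          using t0 tT by (intro u') simp
        moreover have "((\<lambda>\<theta>. t + \<theta> * h) has_vector_derivative h) (at \<theta>)"
          by (auto intro!: derivative_eq_intros simp flip: has_real_derivative_iff_has_vector_derivative)
        ultimately show ?thesis using vector_diff_chain_at by (fastforce simp: o_def)
      qed
      show "1 \<le> B" by (simp add: B_def)
    qed (use F J F2 bounds ball[OF t] b1 b2 on_strip[OF t] h P inside small in \<open>auto simp: h_def\<close>)
    then show "norm (local_error b1 b2 F J S u T N n) \<le> K * (T / real N) ^ 4"
      by (simp add: local_error_def next_t flip: h_def t_def)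
  qed
  then show ?thesis ..
qed

end
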